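(* Let $G$ be a finite graph on vertex set $V$, and let $V = V_1 \sqcup V_2 \sqcup \dots \sqcup V_m$ be a partition of $V$. Let $n \ge m+1$ and $q \ge 2$ be integers such that $|V_j| \ge q-1$ for all $j$, $|V| \le (q-1)n+1$, and such that there is no $\mathfrak S_q$-equivariant continuous map $\mathrm{I}(G)^{*q}_\Delta \to S(W_q^{\oplus n})$. Let $H$ be a graph on vertex set $V$ obtained from $G$ by adding the edges of a simple path (on vertices of $V$). Then $H$ admits an almost fair splitting by $q$ independent sets (independent in $H$).
   Context: A set of vertices is independent if it contains no two endpoints of an edge; $\mathrm{I}(G)$ is the simplicial complex of all independent sets of $G$, regarded as a topological space via geometric realization. For a simplicial complex $K$, the $q$-fold deleted join $K^{*q}_\Delta$ is the subcomplex of the $q$-fold join of $q$ disjoint copies of $K$ consisting of faces $\sigma_1 * \dots * \sigma_q$ with $\sigma_i \in K$ pairwise disjoint as subsets of the vertex set of $K$ (empty faces allowed); $\mathfrak S_q$ acts by permuting the join factors. $W_q = \{(y_1, \dots, y_q) \in \mathbb{R}^q : \sum y_i = 0\}$ with $\mathfrak S_q$ permuting coordinates; $W_q^{\oplus n}$ is the $n$-fold direct sum with the diagonal action and $S(W_q^{\oplus n})$ its unit sphere. Given the partition, pairwise disjoint sets $S_1, \dots, S_q \subseteq V$ form an almost fair splitting if $|S_i \cap V_j| \ge \lfloor \frac{|V_j|+1}{q} \rfloor - 1$ for all $i,j$ and $|V_j \setminus \bigcup_i S_i| \le q-1$ for all $j$. *)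

theory Defs
  imports "HOL-Analysis.Analysis" "HOL-Combinatorics.Permutations"
begin

definition finite_graph :: "'v set \<Rightarrow> 'v set set \<Rightarrow> bool" where
  "finite_graph V E \<longleftrightarrow> finite V \<and> (\<forall>e\<in>E. e \<subseteq> V \<and> card e = 2)"

definition independent_set :: "'v set \<Rightarrow> 'v set set \<Rightarrow> 'v set \<Rightarrow> bool" where
  "independent_set V E S \<longleftrightarrow> S \<subseteq> V \<and> (\<forall>u\<in>S. \<forall>v\<in>S. {u, v} \<notin> E)"

definition independence_complex :: "'v set \<Rightarrow> 'v set set \<Rightarrow> 'v set set" where
  "independence_complex V E = {S. independent_set V E S}"

definition simple_graph_path :: "'v set \<Rightarrow> 'v list \<Rightarrow> bool" where
  "simple_graph_path V p \<longleftrightarrow> p \<noteq> [] \<and> distinct p \<and> set p \<subseteq> V"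

definition path_edges :: "'v list \<Rightarrow> 'v set set" where
  "path_edges p = {{p ! k, p ! Suc k} | k. Suc k < length p}"

text \<open>Points are given by their barycentric coordinates. As a subspace of the function space
  (with its product topology) this carries the usual topology of the geometric realization
  whenever the complex is finite. The empty face, if present, contributes no point.\<close>

definition geom_realization :: "'a set set \<Rightarrow> ('a \<Rightarrow> real) set" where
  "geom_realization K =
     {x. (\<forall>a. 0 \<le> x a) \<and> {a. x a \<noteq> 0} \<in> K \<and> (\<Sum>a\<in>{a. x a \<noteq> 0}. x a) = 1}"

text \<open>The vertex \<open>(v, i)\<close> is the copy of \<open>v\<close> in the \<open>i\<close>-th join factor.\<close>

definition deleted_join :: "nat \<Rightarrow> 'v set set \<Rightarrow> ('v \<times> nat) set set" where
  "deleted_join q K =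
     {(\<Union>i\<in>{1..q}. \<sigma> i \<times> {i}) | \<sigma>. (\<forall>i\<in>{1..q}. \<sigma> i \<in> K) \<and> disjoint_family_on \<sigma> {1..q}}"

definition join_action :: "(nat \<Rightarrow> nat) \<Rightarrow> ('v \<times> nat \<Rightarrow> real) \<Rightarrow> ('v \<times> nat \<Rightarrow> real)" where
  "join_action \<pi> x = (\<lambda>(v, i). x (v, inv \<pi> i))"

text \<open>Vectors in \<open>\<real>\<^sup>q\<close> are functions on \<open>{1..q}\<close> extended by zero, and similarly for the
  \<open>n\<close>-fold direct sum.\<close>

definition W :: "nat \<Rightarrow> (nat \<Rightarrow> real) set" where
  "W q = {y. (\<forall>i. i \<notin> {1..q} \<longrightarrow> y i = 0) \<and> (\<Sum>i\<in>{1..q}. y i) = 0}"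

definition W_sum :: "nat \<Rightarrow> nat \<Rightarrow> (nat \<Rightarrow> nat \<Rightarrow> real) set" where
  "W_sum q n = {z. (\<forall>j\<in>{1..n}. z j \<in> W q) \<and> (\<forall>j. j \<notin> {1..n} \<longrightarrow> z j = (\<lambda>_. 0))}"

definition W_sphere :: "nat \<Rightarrow> nat \<Rightarrow> (nat \<Rightarrow> nat \<Rightarrow> real) set" where
  "W_sphere q n = {z \<in> W_sum q n. (\<Sum>j\<in>{1..n}. \<Sum>i\<in>{1..q}. (z j i)\<^sup>2) = 1}"

definition W_action :: "(nat \<Rightarrow> nat) \<Rightarrow> (nat \<Rightarrow> nat \<Rightarrow> real) \<Rightarrow> (nat \<Rightarrow> nat \<Rightarrow> real)" where
  "W_action \<pi> z = (\<lambda>j i. z j (inv \<pi> i))"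

definition equivariant_map ::
  "nat \<Rightarrow> nat \<Rightarrow> 'v set set \<Rightarrow> (('v \<times> nat \<Rightarrow> real) \<Rightarrow> (nat \<Rightarrow> nat \<Rightarrow> real)) \<Rightarrow> bool" where
  "equivariant_map q n K f \<longleftrightarrow>
     continuous_on (geom_realization (deleted_join q K)) f \<and>
     f ` geom_realization (deleted_join q K) \<subseteq> W_sphere q n \<and>
     (\<forall>\<pi>. \<pi> permutes {1..q} \<longrightarrow>
        (\<forall>x\<in>geom_realization (deleted_join q K). f (join_action \<pi> x) = W_action \<pi> (f x)))"

definition almost_fair_splitting ::
  "'v set \<Rightarrow> nat \<Rightarrow> (nat \<Rightarrow> 'v set) \<Rightarrow> nat \<Rightarrow> (nat \<Rightarrow> 'v set) \<Rightarrow> bool" where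
  "almost_fair_splitting V m P q S \<longleftrightarrow>
     (\<forall>i\<in>{1..q}. S i \<subseteq> V) \<and> disjoint_family_on S {1..q} \<and>
     (\<forall>i\<in>{1..q}. \<forall>j\<in>{1..m}.
        int (card (S i \<inter> P j)) \<ge> \<lfloor>(real (card (P j)) + 1) / real q\<rfloor> - 1) \<and>
     (\<forall>j\<in>{1..m}. card (P j - (\<Union>i\<in>{1..q}. S i)) \<le> q - 1)"

end

theory Submission
  imports Defs
begin

text \<open>Assume there is no splitting. A partial colouring \<open>c\<close> of \<open>V\<close> with independent colour classes
  (colour \<open>0\<close> meaning uncoloured) is a face of the deleted join, and a chain of such colourings is a
  simplex of its barycentric subdivision. An equivariant labelling of the colourings by vectors of
  \<open>W_sum q n\<close> such that no chain has \<open>0\<close> in the convex hull of its labels then gives a map to the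
  sphere, contrary to hypothesis.

  Write \<open>|P j| + 1 = q * t + s\<close> with \<open>s < q\<close>. Coordinate \<open>j \<le> m\<close> of the label is the sum of the unit
  vectors of the colours occurring at least \<open>t\<close> times in \<open>P j\<close>; if that is every colour, it is
  minus the unit vector of the colour of one chosen vertex of \<open>P j\<close>. The last \<open>n - m\<close> coordinates
  are used only by colourings that leave at least \<open>q - 1\<close> vertices of every \<open>P j\<close> uncoloured: order
  \<open>V\<close> so that the path comes first and consecutively, and use the unit vector of the first colour
  in the copy of \<open>W q\<close> determined by the number of monochromatic runs, \<open>q - 1\<close> run numbers per copy.
  Along a chain the run number increases, and the first colour can change only if it does, so
  each copy sees fewer than \<open>q\<close> colours. Hence a vanishing combination contains a
  colouring with \<open>(q - 1) * (n - m) + 1\<close> runs; by the bound on \<open>card V\<close> it leaves exactly \<open>q - 1\<close>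
  vertices of each \<open>P j\<close> uncoloured and has no two consecutive vertices of equal colour, and the
  first \<open>m\<close> coordinates force it to be fair.\<close>

section \<open>Labels for a single block of the partition\<close>

definition colour_count :: "('v \<Rightarrow> nat) \<Rightarrow> 'v set \<Rightarrow> nat \<Rightarrow> nat" where
  "colour_count c X i = card {v \<in> X. c v = i}"

text \<open>The second argument is the larger colouring.\<close>

definition extends :: "('v \<Rightarrow> nat) \<Rightarrow> ('v \<Rightarrow> nat) \<Rightarrow> bool" where
  "extends c c' \<longleftrightarrow> (\<forall>v. c v \<noteq> 0 \<longrightarrow> c' v = c v)"

definition saturated :: "nat \<Rightarrow> nat \<Rightarrow> 'v set \<Rightarrow> ('v \<Rightarrow> nat) \<Rightarrow> bool" where
  "saturated q t X c \<longleftrightarrow> (\<forall>i\<in>{1..q}. t \<le> colour_count c X i)"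

text \<open>The chosen vertex depends only on which vertices of \<open>X\<close> are coloured, not
  on their colours. Hence permuting the colours permutes the key colour accordingly.\<close>

definition key_colour :: "'v set \<Rightarrow> ('v \<Rightarrow> nat) \<Rightarrow> nat" where
  "key_colour X c = c (SOME v. v \<in> X \<and> c v \<noteq> 0)"

text \<open>Only differences between coordinates matter, as constant vectors are projected away
  later. The indicator vector of the frequent colours becomes constant when every colour is
  frequent, which is why the key colour takes over there.\<close>

definition fair_label :: "nat \<Rightarrow> nat \<Rightarrow> 'v set \<Rightarrow> ('v \<Rightarrow> nat) \<Rightarrow> nat \<Rightarrow> real" where
  "fair_label q t X c i =
     (if saturated q t X c then (if i = key_colour X c then -1 else 0)
      else if t \<le> colour_count c X i then 1 else 0)"

lemma extends_refl: "extends c c"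
  by (simp add: extends_def)

lemma extends_trans: "extends a b \<Longrightarrow> extends b c \<Longrightarrow> extends a c"
  by (simp add: extends_def)

lemma colour_count_mono:
  assumes "finite X" "extends c c'" "i \<noteq> 0"
  shows "colour_count c X i \<le> colour_count c' X i"
  unfolding colour_count_def using assms by (intro card_mono) (auto simp: extends_def)

lemma sum_colour_count:
  assumes "finite X" "\<And>v. v \<in> X \<Longrightarrow> c v \<le> q"
  shows "(\<Sum>i\<in>{1..q}. colour_count c X i) = card {v \<in> X. c v \<noteq> 0}"
proof -
  have "{v \<in> X. c v \<noteq> 0} = (\<Union>i\<in>{1..q}. {v \<in> X. c v = i})"
    using assms(2) by (auto simp: Suc_le_eq)
  moreover have "card (\<Union>i\<in>{1..q}. {v \<in> X. c v = i}) = (\<Sum>i\<in>{1..q}. card {v \<in> X. c v = i})"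
    using assms(1) by (intro card_UN_disjoint) auto
  ultimately show ?thesis by (simp add: colour_count_def)
qed

lemma key_colour_cong:
  assumes "\<And>v. v \<in> X \<Longrightarrow> c v = c' v" "\<exists>v\<in>X. c v \<noteq> 0"
  shows "key_colour X c = key_colour X c'"
proof -
  have *: "(\<lambda>v. v \<in> X \<and> c v \<noteq> 0) = (\<lambda>v. v \<in> X \<and> c' v \<noteq> 0)" using assms(1) by auto
  have "(SOME v. v \<in> X \<and> c v \<noteq> 0) \<in> X"
    using someI_ex[of "\<lambda>v. v \<in> X \<and> c v \<noteq> 0"] assms(2) by blast
  then show ?thesis unfolding key_colour_def * using assms(1) by (metis *)
qed

lemma key_colour_in:
  assumes "\<exists>v\<in>X. c v \<noteq> 0" "\<And>v. v \<in> X \<Longrightarrow> c v \<le> q"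
  shows "key_colour X c \<in> {1..q}"
proof -
  define u where "u = (SOME v. v \<in> X \<and> c v \<noteq> 0)"
  have "u \<in> X \<and> c u \<noteq> 0"
    unfolding u_def using someI_ex[of "\<lambda>v. v \<in> X \<and> c v \<noteq> 0"] assms(1) by blast
  then show ?thesis using assms(2)[of u] unfolding key_colour_def u_def[symmetric] by simp
qed

text \<open>Equal cardinality forces the sets of coloured vertices in \<open>X\<close> to coincide,
  so the colourings agree on \<open>X\<close>. Along a chain the key colour can thus change only
  when the number of coloured vertices does.\<close>

lemma key_colour_extends_eq:
  assumes "finite X" "extends c c'" "card {v\<in>X. c v \<noteq> 0} = card {v\<in>X. c' v \<noteq> 0}"
    "\<exists>v\<in>X. c v \<noteq> 0"
  shows "key_colour X c = key_colour X c'"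
proof -
  have "{v\<in>X. c v \<noteq> 0} = {v\<in>X. c' v \<noteq> 0}"
    using assms by (intro card_subset_eq) (auto simp: extends_def)
  then have same: "c v \<noteq> 0 \<longleftrightarrow> c' v \<noteq> 0" if "v \<in> X" for v using that by blast
  have "c v = c' v" if "v \<in> X" for v
    using same[OF that] assms(2) unfolding extends_def by (cases "c v = 0") auto
  then show ?thesis using assms(4) by (rule key_colour_cong)
qed

lemma saturated_coloured:
  assumes "saturated q t X c" "1 \<le> t" "1 \<le> q"
  shows "\<exists>v\<in>X. c v \<noteq> 0"
proof -
  have "1 \<le> colour_count c X 1" using assms by (force simp: saturated_def)
  then have "{v \<in> X. c v = 1} \<noteq> {}" unfolding colour_count_def by (metis card.empty not_one_le_zero)
  then show ?thesis by force
qed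

text \<open>A saturated member with \<open>g\<close> coloured points has at most \<open>q * t + s - g\<close> possible sizes of
  saturated members above it, whereas the excess of \<open>T\<close> forces more than that many colours to
  occur \<open>t\<close> times in \<open>T\<close>.\<close>

lemma free_colour:
  assumes X: "finite X" "card X + 1 = q * t + s" and "1 \<le> t"
    and chain: "\<And>c c'. c \<in> C \<Longrightarrow> c' \<in> C \<Longrightarrow> extends c c' \<or> extends c' c"
    and range: "\<And>c v. c \<in> C \<Longrightarrow> v \<in> X \<Longrightarrow> c v \<le> q"
    and A_def: "A = {i\<in>{1..q}. t \<le> colour_count T X i}"
    and excess: "card A * (t - 1) + s + 1 \<le> (\<Sum>i\<in>A. colour_count T X i)"
  shows "\<exists>i\<in>A. \<forall>c\<in>C. extends T c \<and> saturated q t X c \<longrightarrow> key_colour X c \<noteq> i"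
proof (rule ccontr)
  assume "\<not> ?thesis"
  then have "\<forall>i\<in>A. \<exists>c\<in>C. extends T c \<and> saturated q t X c \<and> key_colour X c = i" by blast
  then obtain d where d: "\<And>i. i \<in> A \<Longrightarrow> d i \<in> C \<and> extends T (d i) \<and> saturated q t X (d i) \<and> key_colour X (d i) = i"
    by metis
  define sz where "sz c = card {v\<in>X. c v \<noteq> 0}" for c :: "'a \<Rightarrow> nat"
  have finA: "finite A" by (simp add: A_def)
  have Ane: "A \<noteq> {}" using excess by auto
  then have q1: "1 \<le> q" by (auto simp: A_def)
  \<comment> \<open>\<open>d a\<close> is the smallest of the chosen saturated members. The sizes
    between \<open>sz (d a)\<close> and \<open>card X\<close> have to accommodate a different value
    for each colour in \<open>A\<close>.\<close>
  obtain a where a: "a \<in> A" "\<And>i. i \<in> A \<Longrightarrow> sz (d a) \<le> sz (d i)"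
    using arg_min_if_finite(1)[OF finA Ane, of "\<lambda>i. sz (d i)"] arg_min_least[OF finA Ane, of _ "\<lambda>i. sz (d i)"]
    by blast
  have inj: "inj_on (\<lambda>i. sz (d i)) A"
  proof (rule inj_onI)
    fix i j assume ij: "i \<in> A" "j \<in> A" "sz (d i) = sz (d j)"
    have "\<exists>v\<in>X. d i v \<noteq> 0" "\<exists>v\<in>X. d j v \<noteq> 0" using saturated_coloured d ij q1 \<open>1 \<le> t\<close> by blast+
    then have "key_colour X (d i) = key_colour X (d j)"
      using key_colour_extends_eq[OF X(1), of "d i" "d j"] key_colour_extends_eq[OF X(1), of "d j" "d i"]
        chain[of "d i" "d j"] d[OF ij(1)] d[OF ij(2)] ij(3) unfolding sz_def by force
    then show "i = j" using d[OF ij(1)] d[OF ij(2)] by simp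
  qed
  have "sz (d i) \<le> card X" for i unfolding sz_def using X(1) by (intro card_mono) auto
  then have "(\<lambda>i. sz (d i)) ` A \<subseteq> {sz (d a)..card X}" using a by auto
  then have "card A \<le> card {sz (d a)..card X}" using card_inj_on_le[OF inj] by blast
  then have c1: "card A + sz (d a) \<le> q * t + s"
    using X(2) \<open>sz (d a) \<le> card X\<close> by simp
  have AQ: "A \<subseteq> {1..q}" by (auto simp: A_def)
  have "sz (d a) = (\<Sum>i\<in>{1..q}. colour_count (d a) X i)"
    unfolding sz_def using sum_colour_count[OF X(1), of "d a" q] range[of "d a"] d[OF a(1)] by simp
  also have "\<dots> = (\<Sum>i\<in>{1..q}-A. colour_count (d a) X i) + (\<Sum>i\<in>A. colour_count (d a) X i)"
    using AQ by (simp add: sum.subset_diff)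
  \<comment> \<open>Colours outside \<open>A\<close> occur at least \<open>t\<close> times because
    \<open>d a\<close> is saturated; colours in \<open>A\<close> occur at least as often as in
    \<open>T\<close>.\<close>
  also have "\<dots> \<ge> card ({1..q}-A) * t + (\<Sum>i\<in>A. colour_count T X i)"
  proof (rule add_mono)
    show "card ({1..q}-A) * t \<le> (\<Sum>i\<in>{1..q}-A. colour_count (d a) X i)"
      using d[OF a(1)] sum_bounded_below[of "{1..q}-A" t "colour_count (d a) X"] by (auto simp: saturated_def)
    show "(\<Sum>i\<in>A. colour_count T X i) \<le> (\<Sum>i\<in>A. colour_count (d a) X i)"
      using AQ d[OF a(1)] by (intro sum_mono colour_count_mono X) auto
  qed
  finally have c2: "card ({1..q}-A) * t + card A * (t - 1) + s + 1 \<le> sz (d a)" using excess by linarith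
  have "card ({1..q}-A) + card A = q" using AQ finA by (simp add: card_Diff_subset card_mono card_mono[OF _ AQ, simplified])
  then have "q * t = card ({1..q}-A) * t + card A * t" by (metis add_mult_distrib)
  moreover have "card A * t = card A * (t - 1) + card A" using \<open>1 \<le> t\<close> by (cases t) auto
  ultimately show False using c1 c2 by linarith
qed

text \<open>A free colour \<open>i0\<close> is compared with a colour \<open>i1\<close>. Labels of
  members above \<open>T\<close> are largest at \<open>i0\<close>. Members not above
  \<open>T\<close> exist only if \<open>T\<close> is unsaturated, and then their entry at
  \<open>i1\<close> is 0 while that at \<open>i0\<close> is nonnegative. The label of
  \<open>T\<close> itself makes the inequality strict.\<close>

lemma fair_label_sum_not_constant:
  assumes X: "finite X" "card X + 1 = q * t + s" and "1 \<le> t" "1 \<le> q"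
    and C: "finite C" "T \<in> C" and pos: "\<And>c. c \<in> C \<Longrightarrow> 0 < w c"
    and chain: "\<And>c c'. c \<in> C \<Longrightarrow> c' \<in> C \<Longrightarrow> extends c c' \<or> extends c' c"
    and range: "\<And>c v. c \<in> C \<Longrightarrow> v \<in> X \<Longrightarrow> c v \<le> q"
    and excess: "\<And>A. A = {i\<in>{1..q}. t \<le> colour_count T X i} \<Longrightarrow>
      card A * (t - 1) + s + 1 \<le> (\<Sum>i\<in>A. colour_count T X i)"
    and low: "(\<forall>c\<in>C. extends T c) \<or> \<not> saturated q t X T"
  shows "\<exists>i\<in>{1..q}. \<exists>i'\<in>{1..q}.
    (\<Sum>c\<in>C. w c * fair_label q t X c i) \<noteq> (\<Sum>c\<in>C. w c * fair_label q t X c i')"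
proof -
  define A where "A = {i\<in>{1..q}. t \<le> colour_count T X i}"
  obtain i0 where i0: "i0 \<in> A" "\<And>c. c \<in> C \<Longrightarrow> extends T c \<Longrightarrow> saturated q t X c \<Longrightarrow> key_colour X c \<noteq> i0"
    using free_colour[where C = C and q = q and X = X, OF X \<open>1 \<le> t\<close> chain _ A_def excess[OF A_def]] range
    by blast
  have up: "fair_label q t X c i \<le> fair_label q t X c i0" if "c \<in> C" "extends T c" for c i
  proof -
    have "t \<le> colour_count c X i0"
      using i0(1) colour_count_mono[OF X(1) that(2), of i0] by (auto simp: A_def)
    then show ?thesis using i0(2)[OF that] by (auto simp: fair_label_def)
  qed
  \<comment> \<open>If \<open>T\<close> is saturated, \<open>i1\<close> is its key colour, with
    entry -1; otherwise it is a colour that occurs fewer than \<open>t\<close> times in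
    \<open>T\<close>, with entry 0.\<close>
  obtain i1 where i1: "i1 \<in> {1..q}" "fair_label q t X T i1 < fair_label q t X T i0"
     "saturated q t X T \<or> colour_count T X i1 < t"
  proof (cases "saturated q t X T")
    case True
    have "key_colour X T \<in> {1..q}" using key_colour_in saturated_coloured True range C assms(3,4) by metis
    moreover have "key_colour X T \<noteq> i0" using i0(2)[OF C(2) extends_refl True] .
    ultimately show ?thesis using that True by (simp add: fair_label_def)
  next
    case False
    then obtain i where "i \<in> {1..q}" "colour_count T X i < t" by (auto simp: saturated_def not_le)
    then show ?thesis using that False i0(1) by (simp add: fair_label_def A_def)
  qed
  have le: "fair_label q t X c i1 \<le> fair_label q t X c i0" if c: "c \<in> C" for c
  proof (cases "extends T c")
    case False
    then have ns: "\<not> saturated q t X T" and e: "extends c T" using low chain C c by blast+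
    then have "colour_count c X i1 < t"
      using i1 colour_count_mono[OF X(1) e, of i1] by simp
    moreover from this have "\<not> saturated q t X c" using i1(1) by (auto simp: saturated_def not_le)
    ultimately show ?thesis by (simp add: fair_label_def)
  qed (use up c in blast)
  have "(\<Sum>c\<in>C. w c * fair_label q t X c i1) < (\<Sum>c\<in>C. w c * fair_label q t X c i0)"
    using C i1(2) le pos by (intro sum_strict_mono_ex1) (auto intro!: mult_left_mono less_imp_le)
  moreover have "i0 \<in> {1..q}" using i0(1) by (simp add: A_def)
  ultimately show ?thesis using i1(1) by force
qed

text \<open>Colours outside \<open>A\<close> occur at most \<open>t - 1\<close> times each, so all
  further coloured vertices fall to \<open>A\<close>. In the second alternative a colour occurring
  at most \<open>t - 2\<close> times makes this bound strict and supplies the missing unit.\<close>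

lemma excess_of_size:
  assumes X: "finite X" and range: "\<And>v. v \<in> X \<Longrightarrow> T v \<le> q"
    and A: "A = {i\<in>{1..q}. t \<le> colour_count T X i}" and t: "1 \<le> t"
    and size: "q * (t - 1) + s < card {v\<in>X. T v \<noteq> 0} \<or>
      q * (t - 1) + s \<le> card {v\<in>X. T v \<noteq> 0} \<and> (\<exists>i\<in>{1..q}. colour_count T X i + 1 < t)"
  shows "card A * (t - 1) + s + 1 \<le> (\<Sum>i\<in>A. colour_count T X i)"
proof -
  have AQ: "A \<subseteq> {1..q}" and finA: "finite A" by (auto simp: A)
  have le: "colour_count T X i \<le> t - 1" if "i \<in> {1..q} - A" for i using that by (auto simp: A)
  have qe: "card ({1..q}-A) + card A = q" using AQ finA by (simp add: card_Diff_subset card_mono card_mono[OF _ AQ, simplified])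
  then have q: "q * (t-1) = card ({1..q}-A) * (t-1) + card A * (t-1)" by (metis add_mult_distrib)
  have tot: "card {v\<in>X. T v \<noteq> 0} = (\<Sum>i\<in>{1..q}-A. colour_count T X i) + (\<Sum>i\<in>A. colour_count T X i)"
    using AQ sum_colour_count[OF X range] by (simp add: sum.subset_diff)
  have b: "(\<Sum>i\<in>{1..q}-A. colour_count T X i) \<le> card ({1..q}-A) * (t-1)"
    using sum_bounded_above[of "{1..q}-A" "colour_count T X" "t - 1"] le by simp
  have "(\<Sum>i\<in>{1..q}-A. colour_count T X i) < card ({1..q}-A) * (t-1)"
    if ex: "\<exists>i\<in>{1..q}. colour_count T X i + 1 < t"
  proof -
    have "(\<Sum>i\<in>{1..q}-A. colour_count T X i) < (\<Sum>i\<in>{1..q}-A. t - 1)"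
    proof (intro sum_strict_mono_ex1)
      obtain i where "i \<in> {1..q}" "colour_count T X i + 1 < t" using ex by blast
      then show "\<exists>i\<in>{1..q} - A. colour_count T X i < t - 1" by (intro bexI[of _ i]) (auto simp: A)
    qed (use le in auto)
    then show ?thesis by simp
  qed
  then show ?thesis using size b tot q by linarith
qed

section \<open>Runs of colours along a vertex order\<close>

definition colour_word :: "'v list \<Rightarrow> ('v \<Rightarrow> nat) \<Rightarrow> nat list" where
  "colour_word xs c = map c (filter (\<lambda>v. c v \<noteq> 0) xs)"

definition runs :: "'v list \<Rightarrow> ('v \<Rightarrow> nat) \<Rightarrow> nat" where
  "runs xs c = length (remdups_adj (colour_word xs c))"

text \<open>A nonempty word has at least one run. Run numbers are shifted to start at 0 and cut into
  consecutive intervals of length \<open>q - 1\<close>; copy \<open>k\<close>, counted from 0, takes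
  the \<open>k\<close>-th interval.\<close>

definition path_label :: "nat \<Rightarrow> 'v list \<Rightarrow> ('v \<Rightarrow> nat) \<Rightarrow> nat \<Rightarrow> nat \<Rightarrow> real" where
  "path_label q xs c k i =
     (if (runs xs c - 1) div (q - 1) = k \<and> i = hd (colour_word xs c) then 1 else 0)"

lemma length_remdups_adj_Cons:
  "length (remdups_adj (x # xs)) =
     length (remdups_adj xs) + (if xs \<noteq> [] \<and> x = hd xs then 0 else 1)"
  by (cases xs) auto

text \<open>The word of \<open>c\<close> arises from that of \<open>c'\<close> by deleting letters.
  The correction for different first letters carries the induction: prepending a letter costs a run
  exactly when it differs from the head, and this 0/1 cost obeys the triangle inequality.\<close>

lemma runs_extends:
  assumes "extends c c'" "colour_word xs c \<noteq> []"
  shows "colour_word xs c' \<noteq> [] \<and>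
    runs xs c + (if hd (colour_word xs c) = hd (colour_word xs c') then 0 else 1) \<le> runs xs c'"
  using assms(2)
proof (induction xs)
  case (Cons v xs)
  have word: "colour_word (v # xs) b = (if b v = 0 then colour_word xs b else b v # colour_word xs b)"
    for b :: "'a \<Rightarrow> nat" by (simp add: colour_word_def)
  have "c v \<noteq> 0 \<Longrightarrow> c' v = c v" using assms(1) by (simp add: extends_def)
  then show ?case
    using Cons
    by (cases "c v = 0"; cases "c' v = 0"; cases "colour_word xs c = []")
      (auto simp: word runs_def length_remdups_adj_Cons split: if_splits)
qed (simp add: colour_word_def)

text \<open>In the copy used by some member \<open>b\<close> all entries are nonnegative and the one
  at the first colour of \<open>b\<close> is positive. Another entry vanishes, as the copy has too
  few run numbers for \<open>q\<close> different first colours.\<close>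

lemma path_label_sum_not_constant:
  assumes q: "2 \<le> q" and C: "finite C" "C \<noteq> {}"
    and pos: "\<And>c. c \<in> C \<Longrightarrow> 0 < w c"
    and chain: "\<And>c c'. c \<in> C \<Longrightarrow> c' \<in> C \<Longrightarrow> extends c c' \<or> extends c' c"
    and range: "\<And>c v. c \<in> C \<Longrightarrow> c v \<le> q"
    and ne: "\<And>c. c \<in> C \<Longrightarrow> colour_word xs c \<noteq> []"
    and bound: "\<And>c. c \<in> C \<Longrightarrow> runs xs c \<le> (q - 1) * d"
  shows "\<exists>k<d. \<exists>i\<in>{1..q}. \<exists>i'\<in>{1..q}.
    (\<Sum>c\<in>C. w c * path_label q xs c k i) \<noteq> (\<Sum>c\<in>C. w c * path_label q xs c k i')"
proof -
  obtain b where b: "b \<in> C" using C by blast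
  define k where "k = (runs xs b - 1) div (q - 1)"
  have r1: "1 \<le> runs xs c" if "c \<in> C" for c
    using ne[OF that] by (simp add: runs_def Suc_le_eq)
  have "runs xs b - 1 < (q - 1) * d" using bound[OF b] r1[OF b] by linarith
  then have kd: "k < d" unfolding k_def by (simp add: less_mult_imp_div_less mult.commute)
  have hdq: "hd (colour_word xs c) \<in> {1..q}" if "c \<in> C" for c
  proof -
    have "hd (colour_word xs c) \<in> set (colour_word xs c)" using ne[OF that] by simp
    then show ?thesis using range[OF that] by (auto simp: colour_word_def Suc_le_eq)
  qed
  have hd_eq: "hd (colour_word xs c) = hd (colour_word xs c')"
    if "c \<in> C" "c' \<in> C" "runs xs c = runs xs c'" for c c'
  proof -
    have "hd (colour_word xs c) = hd (colour_word xs c')"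
      if "c \<in> C" "c' \<in> C" "runs xs c = runs xs c'" "extends c c'" for c c'
      using runs_extends[OF that(4) ne[OF that(1)]] that(3) by (auto split: if_splits)
    then show ?thesis using that chain by metis
  qed
  define val where "val i = (\<Sum>c\<in>C. w c * path_label q xs c k i)" for i
  have nonneg: "0 \<le> w c * path_label q xs c k i" if "c \<in> C" for c i
    using pos[OF that] by (simp add: path_label_def)
  have val_pos: "0 < val (hd (colour_word xs b))"
    unfolding val_def using C(1) b pos[OF b] nonneg
    by (intro sum_pos2[of _ b]) (auto simp: path_label_def k_def)
  have "\<exists>i\<in>{1..q}. val i = 0"
  proof (rule ccontr)
    assume none: "\<not> ?thesis"
    have "\<exists>c\<in>C. (runs xs c - 1) div (q - 1) = k \<and> i = hd (colour_word xs c)" if "i \<in> {1..q}" for i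
    proof (rule ccontr)
      assume "\<not> ?thesis"
      then have "val i = 0" unfolding val_def path_label_def by (intro sum.neutral) auto
      then show False using none that by blast
    qed
    then obtain e where e: "\<And>i. i \<in> {1..q} \<Longrightarrow> e i \<in> C \<and> (runs xs (e i) - 1) div (q - 1) = k \<and> i = hd (colour_word xs (e i))"
      by metis
    \<comment> \<open>Within copy \<open>k\<close> the residue recovers the run number, which
      determines the first colour; so \<open>rr\<close> would embed \<open>q\<close> colours into
      \<open>q - 1\<close> residues.\<close>
    define rr where "rr i = (runs xs (e i) - 1) mod (q - 1)" for i
    have "inj_on rr {1..q}"
    proof (rule inj_onI)
      fix i j assume ij: "i \<in> {1..q}" "j \<in> {1..q}" "rr i = rr j"
      have "runs xs (e i) - 1 = runs xs (e j) - 1"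
        using e[OF ij(1)] e[OF ij(2)] ij(3) unfolding rr_def by (metis div_mult_mod_eq)
      then have "runs xs (e i) = runs xs (e j)" using r1 e ij by (metis le_add_diff_inverse)
      then show "i = j" using hd_eq e ij by metis
    qed
    moreover have "rr ` {1..q} \<subseteq> {..<q - 1}" using q by (auto simp: rr_def)
    ultimately have "card {1..q} \<le> card {..<q - 1}" using card_inj_on_le by blast
    then show False using q by simp
  qed
  then obtain i where "i \<in> {1..q}" "val i = 0" by blast
  with val_pos have "val i \<noteq> val (hd (colour_word xs b))" by simp
  then show ?thesis using kd hdq[OF b] \<open>i \<in> {1..q}\<close> unfolding val_def by blast
qed

section \<open>Weights in place of barycentric coordinates\<close>

text \<open>Positive exactly when the coloured pairs \<open>(v, c v)\<close> form an upper level set of \<open>x\<close>; this takes the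
  place of the barycentric coordinates of \<open>x\<close> in the barycentric subdivision.\<close>

definition weight :: "'v set \<Rightarrow> nat \<Rightarrow> ('v \<Rightarrow> nat) \<Rightarrow> ('v \<times> nat \<Rightarrow> real) \<Rightarrow> real" where
  "weight V q c x = (\<Prod>v\<in>{v \<in> V. c v \<noteq> 0}. x (v, c v) *
     (\<Prod>b\<in>{b \<in> V \<times> {1..q}. c (fst b) \<noteq> snd b}. max 0 (x (v, c v) - x b)))"

lemma weight_nonneg:
  assumes "\<And>a. 0 \<le> x a"
  shows "0 \<le> weight V q c x"
  unfolding weight_def using assms by (intro prod_nonneg ballI mult_nonneg_nonneg) auto

lemma weight_pos_iff:
  assumes "finite V" "\<And>a. 0 \<le> x a"
  shows "0 < weight V q c x \<longleftrightarrow>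
    (\<forall>v\<in>V. c v \<noteq> 0 \<longrightarrow> 0 < x (v, c v) \<and> (\<forall>b\<in>V \<times> {1..q}. c (fst b) \<noteq> snd b \<longrightarrow> x b < x (v, c v)))"
    (is "_ \<longleftrightarrow> ?R")
proof
  assume "0 < weight V q c x"
  then have "weight V q c x \<noteq> 0" by simp
  have fin: "finite {v \<in> V. c v \<noteq> 0}" "finite {b \<in> V \<times> {1..q}. c (fst b) \<noteq> snd b}"
    using assms(1) by auto
  have *: "x (v, c v) \<noteq> 0 \<and> (\<forall>b\<in>{b \<in> V \<times> {1..q}. c (fst b) \<noteq> snd b}. max 0 (x (v, c v) - x b) \<noteq> 0)"
    if v: "v \<in> V" "c v \<noteq> 0" for v
  proof -
    have "v \<in> {v \<in> V. c v \<noteq> 0}" using v by simp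
    then have "x (v, c v) * (\<Prod>b\<in>{b \<in> V \<times> {1..q}. c (fst b) \<noteq> snd b}. max 0 (x (v, c v) - x b)) \<noteq> 0"
      using \<open>weight V q c x \<noteq> 0\<close> unfolding weight_def prod_zero_iff[OF fin(1)] by blast
    then show ?thesis unfolding mult_eq_0_iff prod_zero_iff[OF fin(2)] by blast
  qed
  show ?R
  proof (intro ballI impI conjI)
    fix v assume v: "v \<in> V" "c v \<noteq> 0"
    show "0 < x (v, c v)" using *[OF v] assms(2)[of "(v, c v)"] by linarith
    fix b assume "b \<in> V \<times> {1..q}" "c (fst b) \<noteq> snd b"
    then have "max 0 (x (v, c v) - x b) \<noteq> 0" using *[OF v] by blast
    then show "x b < x (v, c v)" by (simp add: max_def split: if_splits)
  qed
next
  assume ?R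
  then show "0 < weight V q c x" unfolding weight_def
    by (intro prod_pos ballI mult_pos_pos) auto
qed

text \<open>Upper level sets of one function are nested: if neither colouring extends the other,
  each has a coloured pair absent from the other, and each of these pairs would have the strictly
  larger value under \<open>x\<close>.\<close>

lemma weight_pos_chain:
  assumes "finite V" "\<And>a. 0 \<le> x a"
    and "0 < weight V q c x" "\<And>v. v \<notin> V \<Longrightarrow> c v = 0" "\<And>v. c v \<le> q"
    and "0 < weight V q c' x" "\<And>v. v \<notin> V \<Longrightarrow> c' v = 0" "\<And>v. c' v \<le> q"
  shows "extends c c' \<or> extends c' c"
proof (rule ccontr)
  assume "\<not> ?thesis"
  then obtain v u where v: "c v \<noteq> 0" "c' v \<noteq> c v" and u: "c' u \<noteq> 0" "c u \<noteq> c' u"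
    unfolding extends_def by metis
  have V: "v \<in> V" "u \<in> V" using v u assms(4,7) by metis+
  have in_VQ: "(u, c' u) \<in> V \<times> {1..q}" "(v, c v) \<in> V \<times> {1..q}"
    using V v u assms(5)[of v] assms(8)[of u] by auto
  have "x (u, c' u) < x (v, c v)"
    using assms(3)[unfolded weight_pos_iff[OF assms(1,2)], rule_format, OF V(1) v(1)] in_VQ(1) u(2)
    by (metis fst_conv snd_conv)
  moreover have "x (v, c v) < x (u, c' u)"
    using assms(6)[unfolded weight_pos_iff[OF assms(1,2)], rule_format, OF V(2) u(1)] in_VQ(2) v(2)
    by (metis fst_conv snd_conv)
  ultimately show False by simp
qed

section \<open>Behaviour under permutations of the colours\<close>

lemma permutes_eq_0_iff:
  assumes "\<pi> permutes {1..q}"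
  shows "\<pi> i = 0 \<longleftrightarrow> i = (0::nat)"
proof -
  have "\<pi> 0 = 0" using permutes_not_in[OF assms, of 0] by simp
  then show ?thesis using inj_eq[OF permutes_inj[OF assms], of i 0] by simp
qed

lemma weight_permute:
  assumes \<pi>: "\<pi> permutes {1..q}"
  shows "weight V q (\<pi> \<circ> c) (join_action \<pi> x) = weight V q c x"
proof -
  have ii: "inv \<pi> (\<pi> i) = i" "\<pi> (inv \<pi> i) = i" for i
    using permutes_inverses[OF \<pi>] by auto
  let ?S = "{b \<in> V \<times> {1..q}. c (fst b) \<noteq> snd b}"
  let ?S' = "{b \<in> V \<times> {1..q}. (\<pi> \<circ> c) (fst b) \<noteq> snd b}"
  \<comment> \<open>Relabelling carries the pairs absent from \<open>c\<close> to those absent from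
    \<open>\<pi> \<circ> c\<close>; the inverse in \<open>join_action\<close> cancels it on the
    values of \<open>x\<close>.\<close>
  have bij: "bij_betw (\<lambda>(w, i). (w, \<pi> i)) ?S ?S'"
    using ii permutes_in_image[OF \<pi>] permutes_in_image[OF permutes_inv[OF \<pi>]]
      inj_eq[OF permutes_inj[OF \<pi>]]
    by (intro bij_betw_byWitness[where f' = "\<lambda>(w, i). (w, inv \<pi> i)"]) auto
  have "(\<Prod>b\<in>?S'. max 0 (y - join_action \<pi> x b)) = (\<Prod>b\<in>?S. max 0 (y - x b))" for y
  proof -
    have "(\<Prod>b\<in>?S'. max 0 (y - join_action \<pi> x b))
        = (\<Prod>b\<in>?S. max 0 (y - join_action \<pi> x ((\<lambda>(w, i). (w, \<pi> i)) b)))"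
      by (rule prod.reindex_bij_betw[OF bij, symmetric])
    also have "\<dots> = (\<Prod>b\<in>?S. max 0 (y - x b))"
      by (intro prod.cong) (auto simp: join_action_def ii)
    finally show ?thesis .
  qed
  then show ?thesis
    unfolding weight_def by (simp add: permutes_eq_0_iff[OF \<pi>] join_action_def ii)
qed

lemma colour_count_permute:
  assumes "\<pi> permutes {1..q}"
  shows "colour_count (\<pi> \<circ> c) X (\<pi> i) = colour_count c X i"
  using permutes_inj[OF assms] by (simp add: colour_count_def inj_eq)

lemma saturated_permute:
  assumes "\<pi> permutes {1..q}"
  shows "saturated q t X (\<pi> \<circ> c) \<longleftrightarrow> saturated q t X c"
proof -
  have "saturated q t X (\<pi> \<circ> c) \<longleftrightarrow> (\<forall>i\<in>\<pi> ` {1..q}. t \<le> colour_count (\<pi> \<circ> c) X i)"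
    unfolding saturated_def permutes_image[OF assms] ..
  also have "\<dots> \<longleftrightarrow> saturated q t X c"
    unfolding saturated_def by (simp add: colour_count_permute[OF assms])
  finally show ?thesis .
qed

lemma fair_label_permute:
  assumes "\<pi> permutes {1..q}"
  shows "fair_label q t X (\<pi> \<circ> c) (\<pi> i) = fair_label q t X c i"
proof -
  have "key_colour X (\<pi> \<circ> c) = \<pi> (key_colour X c)"
    by (simp add: key_colour_def permutes_eq_0_iff[OF assms])
  then show ?thesis
    unfolding fair_label_def saturated_permute[OF assms] colour_count_permute[OF assms]
    using permutes_inj[OF assms] by (simp add: inj_eq)
qed

lemma colour_word_permute:
  assumes "\<pi> permutes {1..q}"
  shows "colour_word xs (\<pi> \<circ> c) = map \<pi> (colour_word xs c)"
  by (simp add: colour_word_def permutes_eq_0_iff[OF assms])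

lemma path_label_permute:
  assumes "\<pi> permutes {1..q}" "colour_word xs c \<noteq> []"
  shows "path_label q xs (\<pi> \<circ> c) k (\<pi> i) = path_label q xs c k i"
proof -
  have inj: "inj \<pi>" using permutes_inj[OF assms(1)] .
  have "runs xs (\<pi> \<circ> c) = runs xs c"
    unfolding runs_def colour_word_permute[OF assms(1)] by (simp add: remdups_adj_map_injective[OF inj])
  then show ?thesis
    unfolding path_label_def colour_word_permute[OF assms(1)]
    using assms(2) inj by (simp add: hd_map inj_eq)
qed

section \<open>From labels to a map into the sphere\<close>

text \<open>The map is the weighted sum of the labels, projected to \<open>W q\<close> in each
  coordinate and scaled to norm 1. Only constant vectors project to 0, so \<open>nonconst\<close>
  keeps the norm positive. The weights need not sum to 1, which the division by \<open>N\<close>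
  makes up for.\<close>

lemma equivariant_map_of_labels:
  fixes V :: "'v set" and C :: "('v \<Rightarrow> nat) set" and L :: "('v \<Rightarrow> nat) \<Rightarrow> nat \<Rightarrow> nat \<Rightarrow> real"
  assumes C: "\<And>\<pi> c. \<pi> permutes {1..q} \<Longrightarrow> c \<in> C \<Longrightarrow> \<pi> \<circ> c \<in> C"
    and L: "\<And>\<pi> c j i. \<pi> permutes {1..q} \<Longrightarrow> c \<in> C \<Longrightarrow> L (\<pi> \<circ> c) j (\<pi> i) = L c j i"
    and nonconst: "\<And>x. x \<in> geom_realization (deleted_join q K) \<Longrightarrow>
      \<exists>j\<in>{1..n}. \<exists>i\<in>{1..q}. \<exists>i'\<in>{1..q}.
        (\<Sum>c\<in>C. weight V q c x * L c j i) \<noteq> (\<Sum>c\<in>C. weight V q c x * L c j i')"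
  shows "\<exists>f. equivariant_map q n K f"
proof -
  define s where "s x j i = (\<Sum>c\<in>C. weight V q c x * L c j i)" for x j i
  \<comment> \<open>Subtracting the mean is the projection onto \<open>W q\<close>; outside the
    index ranges 0 is the default prescribed by \<open>W\<close> and \<open>W_sum\<close>.\<close>
  define g where "g x j i = (if j \<in> {1..n} \<and> i \<in> {1..q}
    then s x j i - (\<Sum>k\<in>{1..q}. s x j k) / q else 0)" for x j i
  define N where "N x = sqrt (\<Sum>j\<in>{1..n}. \<Sum>i\<in>{1..q}. (g x j i)\<^sup>2)" for x
  define f where "f x j i = g x j i / N x" for x j i
  let ?R = "geom_realization (deleted_join q K)"
  have N_pos: "0 < N x" if x: "x \<in> ?R" for x
  proof -
    obtain j i i' where ji: "j \<in> {1..n}" "i \<in> {1..q}" "i' \<in> {1..q}" "s x j i \<noteq> s x j i'"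
      using nonconst[OF x] unfolding s_def by blast
    then have "g x j i \<noteq> g x j i'" by (simp add: g_def)
    then obtain k where k: "k \<in> {1..q}" "g x j k \<noteq> 0" using ji by metis
    have "0 < (\<Sum>i\<in>{1..q}. (g x j i)\<^sup>2)" using k by (intro sum_pos2[of _ k]) auto
    then have "0 < (\<Sum>j\<in>{1..n}. \<Sum>i\<in>{1..q}. (g x j i)\<^sup>2)"
      using ji(1) by (intro sum_pos2[of "{1..n}" j]) (auto intro: sum_nonneg)
    then show ?thesis by (simp add: N_def)
  qed
  have cont_eval: "continuous_on ?R (\<lambda>x. x a)" for a
    by (rule continuous_on_subset[OF continuous_on_product_coordinates]) simp
  have cont_s: "continuous_on ?R (\<lambda>x. s x j i)" for j i
    unfolding s_def weight_def 
    by (intro continuous_on_sum continuous_on_mult continuous_on_prod continuous_on_max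
        continuous_on_diff continuous_on_const cont_eval)
  have cont_g: "continuous_on ?R (\<lambda>x. g x j i)" for j i
    by (cases "j \<in> {1..n} \<and> i \<in> {1..q}") (auto simp: g_def intro!: continuous_intros cont_s)
  have cont_N: "continuous_on ?R N"
    unfolding N_def by (intro continuous_intros cont_g)
  have "continuous_on ?R f"
  proof (intro continuous_on_coordinatewise_then_product)
    show "continuous_on ?R (\<lambda>x. f x j i)" for j i
      unfolding f_def using N_pos by (intro continuous_intros cont_g cont_N) force
  qed
  moreover have "f x \<in> W_sphere q n" if x: "x \<in> ?R" for x
  proof -
    have sum0: "(\<Sum>i\<in>{1..q}. g x j i) = 0" for j
    proof (cases "j \<in> {1..n} \<and> q \<noteq> 0")
      case True
      then have "(\<Sum>i\<in>{1..q}. g x j i) = (\<Sum>i\<in>{1..q}. s x j i - (\<Sum>k\<in>{1..q}. s x j k) / q)"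
        by (intro sum.cong) (auto simp: g_def)
      with True show ?thesis by (simp add: sum_subtractf)
    qed (auto simp: g_def)
    have "(\<Sum>i\<in>{1..q}. f x j i) = 0" for j
      unfolding f_def sum_divide_distrib[symmetric] sum0 by simp
    moreover have "f x j i = 0" if "\<not> (j \<in> {1..n} \<and> i \<in> {1..q})" for j i
      using that by (simp only: f_def g_def if_False div_0)
    ultimately have "f x \<in> W_sum q n"
      unfolding W_sum_def W_def by blast
    moreover have "(\<Sum>j\<in>{1..n}. \<Sum>i\<in>{1..q}. (f x j i)\<^sup>2) = 1"
    proof -
      have "(\<Sum>j\<in>{1..n}. \<Sum>i\<in>{1..q}. (f x j i)\<^sup>2) = (\<Sum>j\<in>{1..n}. \<Sum>i\<in>{1..q}. (g x j i)\<^sup>2) / (N x)\<^sup>2"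
        unfolding f_def power_divide sum_divide_distrib ..
      also have "(\<Sum>j\<in>{1..n}. \<Sum>i\<in>{1..q}. (g x j i)\<^sup>2) = (N x)\<^sup>2"
        unfolding N_def by (simp add: sum_nonneg)
      finally show ?thesis using N_pos[OF x] by simp
    qed
    ultimately show ?thesis by (simp add: W_sphere_def)
  qed
  moreover have "f (join_action \<pi> x) = W_action \<pi> (f x)" if \<pi>: "\<pi> permutes {1..q}" for \<pi> x
  proof -
    have ii: "inv \<pi> (\<pi> i) = i" "\<pi> (inv \<pi> i) = i" for i
      using permutes_inverses[OF \<pi>] by auto
    have bijC: "bij_betw (\<lambda>c. \<pi> \<circ> c) C C"
      using C[OF \<pi>] C[OF permutes_inv[OF \<pi>]] ii
      by (intro bij_betw_byWitness[where f' = "\<lambda>c. inv \<pi> \<circ> c"]) (auto simp: fun_eq_iff)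
    have s_eq: "s (join_action \<pi> x) j (\<pi> i) = s x j i" for j i
    proof -
      have "s (join_action \<pi> x) j (\<pi> i)
          = (\<Sum>c\<in>C. weight V q (\<pi> \<circ> c) (join_action \<pi> x) * L (\<pi> \<circ> c) j (\<pi> i))"
        unfolding s_def by (rule sum.reindex_bij_betw[OF bijC, symmetric])
      also have "\<dots> = s x j i"
        unfolding s_def by (intro sum.cong) (auto simp: weight_permute[OF \<pi>] L[OF \<pi>])
      finally show ?thesis .
    qed
    have sum_eq: "(\<Sum>k\<in>{1..q}. h (\<pi> k)) = (\<Sum>k\<in>{1..q}. h k)" for h :: "nat \<Rightarrow> real"
      using sum.permute[OF \<pi>, of h] by simp
    have "(\<Sum>k\<in>{1..q}. s (join_action \<pi> x) j k) = (\<Sum>k\<in>{1..q}. s x j k)" for j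
      using sum_eq[of "s (join_action \<pi> x) j"] by (simp add: s_eq)
    then have g_eq: "g (join_action \<pi> x) j (\<pi> i) = g x j i" for j i
      using permutes_in_image[OF \<pi>, of i] unfolding g_def s_eq by simp
    have "N (join_action \<pi> x) = N x"
      unfolding N_def using sum_eq[of "\<lambda>i. (g (join_action \<pi> x) j i)\<^sup>2" for j] by (simp add: g_eq)
    then have "f (join_action \<pi> x) j (\<pi> i) = f x j i" for j i by (simp add: f_def g_eq)
    then have "f (join_action \<pi> x) j i = f x j (inv \<pi> i)" for j i using ii by metis
    then show ?thesis by (simp add: W_action_def fun_eq_iff)
  qed
  ultimately show ?thesis unfolding equivariant_map_def by blast
qed

section \<open>Colourings as faces of the deleted join\<close>

text \<open>The colour classes are the disjoint faces being joined. Some vertex has to be coloured,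
  as the empty face carries no point; the default 0 off \<open>V\<close> makes the encoding of a
  face unique.\<close>

definition colourings :: "'v set \<Rightarrow> 'v set set \<Rightarrow> nat \<Rightarrow> ('v \<Rightarrow> nat) set" where
  "colourings V E q = {c. (\<forall>v. v \<notin> V \<longrightarrow> c v = 0) \<and> (\<forall>v. c v \<le> q) \<and> (\<exists>v. c v \<noteq> 0) \<and>
     (\<forall>i\<in>{1..q}. independent_set V E {v. c v = i})}"

lemma finite_colourings:
  assumes "finite V"
  shows "finite (colourings V E q)"
proof (rule finite_subset)
  show "colourings V E q \<subseteq> {c. \<forall>v. (v \<in> V \<longrightarrow> c v \<in> {..q}) \<and> (v \<notin> V \<longrightarrow> c v = 0)}"
    by (auto simp: colourings_def)
qed (rule finite_set_of_finite_funs[OF assms finite_atMost])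

lemma colourings_permute:
  assumes \<pi>: "\<pi> permutes {1..q}" and c: "c \<in> colourings V E q"
  shows "\<pi> \<circ> c \<in> colourings V E q"
proof -
  have "\<pi> i \<le> q" if "i \<le> q" for i
    using permutes_in_image[OF \<pi>, of i] permutes_eq_0_iff[OF \<pi>, of i] that by (cases "i = 0") auto
  moreover have "independent_set V E {v. \<pi> (c v) = i}" if "i \<in> {1..q}" for i
  proof -
    have "{v. \<pi> (c v) = i} = {v. c v = inv \<pi> i}" using permutes_inv_eq[OF \<pi>] by metis
    moreover have "inv \<pi> i \<in> {1..q}" using permutes_in_image[OF permutes_inv[OF \<pi>]] that by blast
    ultimately show ?thesis using c by (simp add: colourings_def)
  qed
  ultimately show ?thesis using c
    by (simp add: colourings_def permutes_eq_0_iff[OF \<pi>] del: neq0_conv)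
qed

text \<open>The support of \<open>x\<close> is itself a colouring, and its weight is positive
  because all other pairs have value 0.\<close>

lemma ex_positive_weight:
  assumes "finite V" and x: "x \<in> geom_realization (deleted_join q (independence_complex V E))"
  shows "\<exists>c\<in>colourings V E q. 0 < weight V q c x"
proof -
  have x0: "\<And>a. 0 \<le> x a" and x1: "(\<Sum>a\<in>{a. x a \<noteq> 0}. x a) = 1"
    and "{a. x a \<noteq> 0} \<in> deleted_join q (independence_complex V E)"
    using x by (auto simp: geom_realization_def)
  then obtain \<sigma> where \<sigma>: "{a. x a \<noteq> 0} = (\<Union>i\<in>{1..q}. \<sigma> i \<times> {i})"
      "\<And>i. i \<in> {1..q} \<Longrightarrow> independent_set V E (\<sigma> i)" "disjoint_family_on \<sigma> {1..q}"
    unfolding deleted_join_def independence_complex_def by auto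
  have "\<exists>k. (\<forall>i\<in>{1..q}. k = i \<longleftrightarrow> v \<in> \<sigma> i) \<and> (k = 0 \<or> k \<in> {1..q})" for v
  proof (cases "\<exists>k\<in>{1..q}. v \<in> \<sigma> k")
    case True
    then obtain k where "k \<in> {1..q}" "v \<in> \<sigma> k" by blast
    then show ?thesis using \<sigma>(3) unfolding disjoint_family_on_def by (intro exI[of _ k]) blast
  next
    case False
    then show ?thesis by (intro exI[of _ 0]) auto
  qed
  then obtain c where "\<forall>v. (\<forall>i\<in>{1..q}. c v = i \<longleftrightarrow> v \<in> \<sigma> i) \<and> (c v = 0 \<or> c v \<in> {1..q})"
    by metis
  then have ceq: "\<And>v i. i \<in> {1..q} \<Longrightarrow> c v = i \<longleftrightarrow> v \<in> \<sigma> i" and c0: "\<And>v. c v = 0 \<or> c v \<in> {1..q}"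
    by blast+
  have supp: "x (v, i) \<noteq> 0 \<longleftrightarrow> i \<in> {1..q} \<and> c v = i" for v i
    using \<sigma>(1) ceq by (auto simp: set_eq_iff)
  have cq: "c v \<le> q" for v using c0[of v] by auto
  have "c \<in> colourings V E q"
  proof -
    have "c v = 0" if "v \<notin> V" for v
      using \<sigma>(2) that c0[of v] ceq unfolding independent_set_def by blast
    moreover have "\<exists>v. c v \<noteq> 0"
    proof (rule ccontr)
      assume "\<not> ?thesis"
      then have "x (v, i) = 0" for v i using supp[of v i] by auto
      then have "{a. x a \<noteq> 0} = {}" by auto
      then show False using x1 by (metis sum.empty zero_neq_one)
    qed
    moreover have "{v. c v = i} = \<sigma> i" if "i \<in> {1..q}" for i using ceq[OF that] by auto
    ultimately show ?thesis using \<sigma>(2) cq by (auto simp: colourings_def)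
  qed
  moreover have "0 < weight V q c x"
  proof (subst weight_pos_iff[OF assms(1) x0], intro ballI impI conjI)
    fix v assume v: "v \<in> V" "c v \<noteq> 0"
    have "x (v, c v) \<noteq> 0" using supp[of v "c v"] v cq[of v] by auto
    then show pos: "0 < x (v, c v)" using x0[of "(v, c v)"] by linarith
    fix b assume "c (fst b) \<noteq> snd b"
    then have "x b = 0" using supp[of "fst b" "snd b"] by auto
    then show "x b < x (v, c v)" using pos by simp
  qed
  ultimately show ?thesis by blast
qed

section \<open>Counting over blocks and along the path\<close>

lemma card_coloured_partition:
  assumes "finite V" "V = (\<Union>j\<in>{1..m}. P j)" "disjoint_family_on P {1..m}"
  shows "card {v \<in> V. Q v} = (\<Sum>j\<in>{1..m::nat}. card {v \<in> P j. Q v})"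
proof -
  have "{v \<in> V. Q v} = (\<Union>j\<in>{1..m}. {v \<in> P j. Q v})" using assms(2) by blast
  moreover have "card (\<Union>j\<in>{1..m}. {v \<in> P j. Q v}) = (\<Sum>j\<in>{1..m}. card {v \<in> P j. Q v})"
  proof (intro card_UN_disjoint ballI impI)
    fix j assume "j \<in> {1..m}"
    then have "P j \<subseteq> V" using assms(2) by blast
    then show "finite {v \<in> P j. Q v}" using assms(1) by (simp add: finite_subset)
  next
    fix i j assume "i \<in> {1..m}" "j \<in> {1..m}" "i \<noteq> j"
    then show "{v \<in> P i. Q v} \<inter> {v \<in> P j. Q v} = {}"
      using assms(3) unfolding disjoint_family_on_def by blast
  qed simp
  ultimately show ?thesis by simp
qed

lemma length_colour_word:
  assumes "distinct xs" "set xs = V"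
  shows "length (colour_word xs c) = card {v \<in> V. c v \<noteq> 0}"
  using assms by (simp add: colour_word_def distinct_length_filter Collect_conj_eq Int_commute)

lemma colour_word_nonempty:
  assumes "c \<in> colourings V E q" "set xs = V"
  shows "colour_word xs c \<noteq> []"
proof -
  obtain v where v: "c v \<noteq> 0" using assms(1) unfolding colourings_def mem_Collect_eq by blast
  moreover have "v \<in> V" using assms(1) v unfolding colourings_def mem_Collect_eq by metis
  ultimately have "v \<in> set (filter (\<lambda>v. c v \<noteq> 0) xs)" using assms(2) by simp
  then show ?thesis unfolding colour_word_def by (metis empty_iff empty_set map_is_Nil_conv)
qed

text \<open>Consecutive path vertices are neighbours in \<open>p @ r\<close>, so if both are
  coloured, their colours are adjacent letters of the word.\<close>

lemma distinct_adj_colour_word_path: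
  assumes "distinct_adj (colour_word (p @ r) c)" "Suc k < length p" "c (p ! k) \<noteq> 0" "c (p ! Suc k) \<noteq> 0"
  shows "c (p ! k) \<noteq> c (p ! Suc k)"
proof -
  have p: "p = take k p @ [p ! k, p ! Suc k] @ drop (Suc (Suc k)) p"
    using assms(2) by (metis Cons_nth_drop_Suc Suc_lessD append_Cons append_Nil append_take_drop_id)
  have "colour_word (p @ r) c = colour_word (take k p) c @ [c (p ! k), c (p ! Suc k)]
      @ colour_word (drop (Suc (Suc k)) p @ r) c"
    using assms(3,4) by (subst p) (simp add: colour_word_def)
  then show ?thesis using assms(1) by (simp add: distinct_adj_append_iff)
qed

lemma finite_chain_has_least:
  assumes "finite C" "C \<noteq> {}"
    and "\<And>c c'. c \<in> C \<Longrightarrow> c' \<in> C \<Longrightarrow> extends c c' \<or> extends c' c"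
  shows "\<exists>c\<in>C. \<forall>c'\<in>C. extends c c'"
  using assms
proof (induction rule: finite_ne_induct)
  case (singleton c)
  then show ?case by (simp add: extends_refl)
next
  case (insert a F)
  then obtain c where c: "c \<in> F" "\<forall>c'\<in>F. extends c c'" by blast
  then show ?case using insert.prems[of a c] extends_trans extends_refl by (metis insert_iff)
qed

section \<open>The full label and the splitting it detects\<close>

text \<open>The additive form of leaving at least \<open>q - 1\<close> vertices of every block
  uncoloured, free of truncated subtraction.\<close>

definition small :: "nat \<Rightarrow> nat \<Rightarrow> (nat \<Rightarrow> 'v set) \<Rightarrow> ('v \<Rightarrow> nat) \<Rightarrow> bool" where
  "small q m P c \<longleftrightarrow> (\<forall>j\<in>{1..m}. card {v \<in> P j. c v \<noteq> 0} + q \<le> card (P j) + 1)"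

text \<open>The shift by \<open>m + 1\<close> turns coordinates \<open>m + 1\<close> to
  \<open>n\<close> into copies 0 to \<open>n - m - 1\<close> of the path label.\<close>

definition label :: "nat \<Rightarrow> nat \<Rightarrow> (nat \<Rightarrow> 'v set) \<Rightarrow> 'v list \<Rightarrow> ('v \<Rightarrow> nat) \<Rightarrow> nat \<Rightarrow> nat \<Rightarrow> real" where
  "label q m P xs c j i =
     (if j \<in> {1..m} then fair_label q ((card (P j) + 1) div q) (P j) c i
      else if small q m P c then path_label q xs c (j - m - 1) i else 0)"

lemma label_permute:
  assumes "\<pi> permutes {1..q}" "colour_word xs c \<noteq> []"
  shows "label q m P xs (\<pi> \<circ> c) j (\<pi> i) = label q m P xs c j i"
proof -
  have "small q m P (\<pi> \<circ> c) = small q m P c"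
    by (simp add: small_def permutes_eq_0_iff[OF assms(1)])
  then show ?thesis
    by (simp add: label_def fair_label_permute[OF assms(1)] path_label_permute[OF assms])
qed

text \<open>As many runs as letters means that no two adjacent letters agree, so the path edges join
  no two vertices of one colour class. The other requirements are the assumed counts.\<close>

lemma splitting_of_full_runs:
  assumes V: "finite V" "V = (\<Union>j\<in>{1..m}. P j)" "disjoint_family_on P {1..m}" and q: "2 \<le> q"
    and c: "c \<in> colourings V E q"
    and xs: "distinct (p @ r)" "set (p @ r) = V"
    and full: "runs (p @ r) c = card {v \<in> V. c v \<noteq> 0}"
    and size: "\<And>j. j \<in> {1..m} \<Longrightarrow> card {v \<in> P j. c v \<noteq> 0} + q = card (P j) + 1"
    and fair: "\<And>i j. i \<in> {1..q} \<Longrightarrow> j \<in> {1..m} \<Longrightarrow> (card (P j) + 1) div q \<le> colour_count c (P j) i + 1"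
  shows "\<exists>S. (\<forall>i\<in>{1..q}. independent_set V (E \<union> path_edges p) (S i)) \<and> almost_fair_splitting V m P q S"
proof (intro exI conjI ballI)
  let ?S = "\<lambda>i. {v. c v = i}"
  have da: "distinct_adj (colour_word (p @ r) c)"
    using full length_colour_word[OF xs, of c] by (simp add: runs_def distinct_adj_conv_length_remdups_adj)
  have sub: "?S i \<subseteq> V" if "i \<in> {1..q}" for i
    using c that by (auto simp: colourings_def)
  show "independent_set V (E \<union> path_edges p) (?S i)" if i: "i \<in> {1..q}" for i
  proof -
    have "{u, v} \<notin> path_edges p" if uv: "c u = i" "c v = i" for u v
    proof
      assume "{u, v} \<in> path_edges p"
      then obtain k where k: "Suc k < length p" "{u, v} = {p ! k, p ! Suc k}"
        by (auto simp: path_edges_def)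
      then have "c (p ! k) = i" "c (p ! Suc k) = i" using uv by (auto simp: doubleton_eq_iff)
      then show False using distinct_adj_colour_word_path[OF da k(1)] i by auto
    qed
    then show ?thesis using c i by (auto simp: colourings_def independent_set_def)
  qed
  show "almost_fair_splitting V m P q ?S"
    unfolding almost_fair_splitting_def
  proof (intro conjI ballI)
    show "disjoint_family_on ?S {1..q}" by (auto simp: disjoint_family_on_def)
    fix j assume j: "j \<in> {1..m}"
    have fin: "finite (P j)" using V(1,2) j by (meson UN_upper finite_subset)
    have "P j - (\<Union>i\<in>{1..q}. ?S i) = P j - {v \<in> P j. c v \<noteq> 0}"
      using c by (auto simp: colourings_def Suc_le_eq)
    then have "card (P j - (\<Union>i\<in>{1..q}. ?S i)) = card (P j) - card {v \<in> P j. c v \<noteq> 0}"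
      using fin by (simp add: card_Diff_subset)
    then show "card (P j - (\<Union>i\<in>{1..q}. ?S i)) \<le> q - 1" using size[OF j] by linarith
    fix i assume i: "i \<in> {1..q}"
    have "\<lfloor>(real (card (P j)) + 1) / real q\<rfloor> = int ((card (P j) + 1) div q)"
      using floor_divide_of_nat_eq[of "card (P j) + 1" q] by (simp add: add.commute)
    moreover have "?S i \<inter> P j = {v \<in> P j. c v = i}" by blast
    ultimately show "\<lfloor>(real (card (P j)) + 1) / real q\<rfloor> - 1 \<le> int (card (?S i \<inter> P j))"
      using fair[OF i j] by (simp add: colour_count_def)
  qed (use sub in blast)
qed

text \<open>If no member is small, the least member is too large in some block, whose fair label is
  then not constant. Otherwise the path coordinates yield a small member with many runs; as there is
  no splitting, it is unfair in some block, and the fair label of that block gives the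
  contradiction.\<close>

lemma label_sum_not_constant:
  assumes V: "finite V" "V = (\<Union>j\<in>{1..m}. P j)" "disjoint_family_on P {1..m}"
    and n: "m \<le> n" and q: "2 \<le> q"
    and P: "\<forall>j\<in>{1..m}. q - 1 \<le> card (P j)"
    and card_V: "card V \<le> (q - 1) * n + 1"
    and xs: "distinct (p @ r)" "set (p @ r) = V"
    and no_splitting: "\<nexists>S. (\<forall>i\<in>{1..q}. independent_set V (E \<union> path_edges p) (S i)) \<and>
      almost_fair_splitting V m P q S"
    and C: "finite C" "C \<noteq> {}" "C \<subseteq> colourings V E q"
    and pos: "\<And>c. c \<in> C \<Longrightarrow> 0 < w c"
    and chain: "\<And>c c'. c \<in> C \<Longrightarrow> c' \<in> C \<Longrightarrow> extends c c' \<or> extends c' c"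
  shows "\<exists>j\<in>{1..n}. \<exists>i\<in>{1..q}. \<exists>i'\<in>{1..q}.
    (\<Sum>c\<in>C. w c * label q m P (p @ r) c j i) \<noteq> (\<Sum>c\<in>C. w c * label q m P (p @ r) c j i')"
proof (rule ccontr)
  assume "\<not> ?thesis"
  then have const: "(\<Sum>c\<in>C. w c * label q m P (p @ r) c j i) = (\<Sum>c\<in>C. w c * label q m P (p @ r) c j i')"
    if "j \<in> {1..n}" "i \<in> {1..q}" "i' \<in> {1..q}" for j i i' using that by blast
  have range: "c v \<le> q" if "c \<in> C" for c v using C(3) that by (auto simp: colourings_def)
  have word_ne: "colour_word (p @ r) c \<noteq> []" if "c \<in> C" for c
    using colour_word_nonempty[OF subsetD[OF C(3) that] xs(2)] .
  \<comment> \<open>The first alternative serves the least member of a chain without small members,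
    the second a member with exactly \<open>q - 1\<close> uncoloured vertices in
    \<open>P j\<close>.\<close>
  have unfair: False
    if j: "j \<in> {1..m}" and T: "T \<in> C"
      and size: "card (P j) + 1 < card {v \<in> P j. T v \<noteq> 0} + q \<and> (\<forall>c\<in>C. extends T c) \<or>
        card (P j) + 1 = card {v \<in> P j. T v \<noteq> 0} + q \<and>
        (\<exists>i\<in>{1..q}. colour_count T (P j) i + 1 < (card (P j) + 1) div q)"
    for j T
  proof -
    define t where "t = (card (P j) + 1) div q"
    define s where "s = (card (P j) + 1) mod q"
    have X: "finite (P j)" "card (P j) + 1 = q * t + s"
      using V(1,2) j by (meson UN_upper finite_subset) (simp add: t_def s_def)
    have "q \<le> card (P j) + 1" using P j q by fastforce
    then have t1: "1 \<le> t" using q by (simp add: t_def div_greater_zero_iff Suc_le_eq)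
    \<comment> \<open>Hence \<open>q * (t - 1) + s\<close> equals \<open>card (P j) + 1 - q\<close>,
      the largest number of coloured vertices that \<open>small\<close> allows in
      \<open>P j\<close>.\<close>
    have "q * (t - 1) + q = q * t" using t1 by (cases t) auto
    then have size': "q * (t - 1) + s < card {v \<in> P j. T v \<noteq> 0} \<or>
      q * (t - 1) + s \<le> card {v \<in> P j. T v \<noteq> 0} \<and> (\<exists>i\<in>{1..q}. colour_count T (P j) i + 1 < t)"
      using size X(2) unfolding t_def[symmetric] by linarith
    have excess: "card A * (t - 1) + s + 1 \<le> (\<Sum>i\<in>A. colour_count T (P j) i)"
      if "A = {i\<in>{1..q}. t \<le> colour_count T (P j) i}" for A
      using excess_of_size[OF X(1) range[OF T] that t1 size'] .
    have low: "(\<forall>c\<in>C. extends T c) \<or> \<not> saturated q t (P j) T"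
      using size unfolding t_def[symmetric] saturated_def by force
    have "1 \<le> q" using q by simp
    have "\<exists>i\<in>{1..q}. \<exists>i'\<in>{1..q}.
      (\<Sum>c\<in>C. w c * fair_label q t (P j) c i) \<noteq> (\<Sum>c\<in>C. w c * fair_label q t (P j) c i')"
      by (rule fair_label_sum_not_constant[where C = C and T = T and q = q and X = "P j" and s = s,
            OF X t1 \<open>1 \<le> q\<close> C(1) T pos chain _ excess low]) (use range in simp_all)
    then obtain i i' where i: "i \<in> {1..q}" "i' \<in> {1..q}"
      "(\<Sum>c\<in>C. w c * fair_label q t (P j) c i) \<noteq> (\<Sum>c\<in>C. w c * fair_label q t (P j) c i')"
      by blast
    have jn: "j \<in> {1..n}" using j n by simp
    have "label q m P (p @ r) c j i = fair_label q t (P j) c i" for c i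
      using j unfolding label_def t_def by (rule if_P)
    then show False using const[OF jn i(1,2)] i(3) by simp
  qed
  show False
  proof (cases "\<exists>c\<in>C. small q m P c")
    case True
    define D where "D = {c \<in> C. small q m P c}"
    have D: "finite D" "D \<noteq> {}" "D \<subseteq> C" using True C(1) by (auto simp: D_def)
    \<comment> \<open>Only small members contribute to the last \<open>n - m\<close> coordinates.
      With at most \<open>(q - 1) * (n - m)\<close> runs each, they would make one of these
      coordinates non-constant.\<close>
    have "\<exists>c\<in>D. (q - 1) * (n - m) < runs (p @ r) c"
    proof (rule ccontr)
      assume "\<not> ?thesis"
      then have bound: "\<And>c. c \<in> D \<Longrightarrow> runs (p @ r) c \<le> (q - 1) * (n - m)" by force
      have "\<exists>k<n - m. \<exists>i\<in>{1..q}. \<exists>i'\<in>{1..q}.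
        (\<Sum>c\<in>D. w c * path_label q (p @ r) c k i) \<noteq> (\<Sum>c\<in>D. w c * path_label q (p @ r) c k i')"
      proof (rule path_label_sum_not_constant[OF q D(1,2)])
        fix c assume "c \<in> D"
        then have "c \<in> C" using D(3) by blast
        then show "0 < w c" "\<And>v. c v \<le> q" "colour_word (p @ r) c \<noteq> []"
          using pos range word_ne by blast+
        show "runs (p @ r) c \<le> (q - 1) * (n - m)" using \<open>c \<in> D\<close> by (rule bound)
        show "extends c c' \<or> extends c' c" if "c' \<in> D" for c'
          using chain \<open>c \<in> C\<close> that D(3) by blast
      qed
      then obtain k i i' where k: "k < n - m" "i \<in> {1..q}" "i' \<in> {1..q}"
        "(\<Sum>c\<in>D. w c * path_label q (p @ r) c k i) \<noteq> (\<Sum>c\<in>D. w c * path_label q (p @ r) c k i')"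
        by blast
      have "(\<Sum>c\<in>C. w c * label q m P (p @ r) c (m + 1 + k) i) = (\<Sum>c\<in>D. w c * path_label q (p @ r) c k i)" for i
        unfolding D_def using C(1)
        by (subst sum.inter_filter) (auto simp: label_def intro!: sum.cong)
      moreover have "m + 1 + k \<in> {1..n}" using k(1) by auto
      ultimately show False using const[of "m + 1 + k" i i'] k by simp
    qed
    then obtain c where c: "c \<in> C" "small q m P c" "(q - 1) * (n - m) < runs (p @ r) c"
      by (auto simp: D_def)
    let ?a = "\<lambda>j. card {v \<in> P j. c v \<noteq> 0}"
    have le: "?a j + (q - 1) \<le> card (P j)" if "j \<in> {1..m}" for j
      using c(2)[unfolded small_def, rule_format, OF that] q by linarith
    have runs_le: "runs (p @ r) c \<le> card {v \<in> V. c v \<noteq> 0}"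
      using remdups_adj_length[of "colour_word (p @ r) c"] unfolding runs_def length_colour_word[OF xs] .
    have sumV: "card V = (\<Sum>j\<in>{1..m}. card (P j))"
      using card_coloured_partition[OF V, of "\<lambda>_. True"] by simp
    have suma: "card {v \<in> V. c v \<noteq> 0} = (\<Sum>j\<in>{1..m}. ?a j)"
      by (rule card_coloured_partition[OF V])
    have sum_le: "(\<Sum>j\<in>{1..m}. ?a j + (q - 1)) \<le> (\<Sum>j\<in>{1..m}. card (P j))"
      by (rule sum_mono) (rule le)
    \<comment> \<open>The run number is at least \<open>(q - 1) * (n - m) + 1\<close> and at most
      the number of coloured vertices, which is at most \<open>card V - (q - 1) * m\<close>. The
      bound on \<open>card V\<close> closes the circle, so equality holds throughout.\<close>
    have "(q - 1) * n = (q - 1) * (n - m) + (q - 1) * m"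
      using n by (simp flip: add_mult_distrib2)
    then have "(\<Sum>j\<in>{1..m}. card (P j)) \<le> (\<Sum>j\<in>{1..m}. ?a j + (q - 1))"
      and full: "runs (p @ r) c = card {v \<in> V. c v \<noteq> 0}"
      using c(3) runs_le card_V sumV suma sum_le by (simp_all add: sum.distrib mult.commute)
    then have eq: "(\<Sum>j\<in>{1..m}. ?a j + (q - 1)) = (\<Sum>j\<in>{1..m}. card (P j))" using sum_le by linarith
    have size: "?a j + q = card (P j) + 1" if "j \<in> {1..m}" for j
    proof -
      have "?a j + (q - 1) = card (P j)"
        using sum_mono_inv[OF eq] le that by simp
      then show ?thesis using q by simp
    qed
    obtain i j where ij: "i \<in> {1..q}" "j \<in> {1..m}" "colour_count c (P j) i + 1 < (card (P j) + 1) div q"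
      using splitting_of_full_runs[OF V q _ xs full size, of E] no_splitting c(1) C(3)
      by (meson not_le subsetD)
    show False
      by (rule unfair[OF ij(2) c(1)], rule disjI2) (use ij size[OF ij(2)] in \<open>force\<close>)
  next
    case False
    obtain T where T: "T \<in> C" "\<forall>c\<in>C. extends T c"
      using finite_chain_has_least[OF C(1,2) chain] by blast
    then obtain j where "j \<in> {1..m}" "card (P j) + 1 < card {v \<in> P j. T v \<noteq> 0} + q"
      using False unfolding small_def by (meson not_le)
    then show False using unfair T by blast
  qed
qed

section \<open>Assembling the equivariant map\<close>

lemma ex_equivariant_map_if_no_splitting:
  assumes V: "finite V" "V = (\<Union>j\<in>{1..m}. P j)" "disjoint_family_on P {1..m}"
    and n: "m \<le> n" and q: "2 \<le> q"
    and P: "\<forall>j\<in>{1..m}. q - 1 \<le> card (P j)"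
    and card_V: "card V \<le> (q - 1) * n + 1"
    and path: "simple_graph_path V p"
    and no_splitting: "\<nexists>S. (\<forall>i\<in>{1..q}. independent_set V (E \<union> path_edges p) (S i)) \<and>
      almost_fair_splitting V m P q S"
  shows "\<exists>f. equivariant_map q n (independence_complex V E) f"
proof -
  obtain r where r: "distinct r" "set r = V - set p"
    using finite_distinct_list[of "V - set p"] V(1) by blast
  have xs: "distinct (p @ r)" "set (p @ r) = V"
    using path r by (auto simp: simple_graph_path_def)
  let ?C = "colourings V E q"
  show ?thesis
  proof (rule equivariant_map_of_labels[where V = V and C = ?C and L = "label q m P (p @ r)"])
    fix x assume x: "x \<in> geom_realization (deleted_join q (independence_complex V E))"
    then have x0: "0 \<le> x a" for a unfolding geom_realization_def by blast
    \<comment> \<open>Colourings of weight 0 contribute nothing to the sums at \<open>x\<close>, and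
      those of positive weight form a chain.\<close>
    define D where "D = {c \<in> ?C. 0 < weight V q c x}"
    have "\<exists>j\<in>{1..n}. \<exists>i\<in>{1..q}. \<exists>i'\<in>{1..q}.
      (\<Sum>c\<in>D. weight V q c x * label q m P (p @ r) c j i) \<noteq> (\<Sum>c\<in>D. weight V q c x * label q m P (p @ r) c j i')"
    proof (rule label_sum_not_constant[OF V n q P card_V xs no_splitting])
      show "D \<noteq> {}" using ex_positive_weight[OF V(1) x] by (auto simp: D_def)
      show "extends c c' \<or> extends c' c" if "c \<in> D" "c' \<in> D" for c c'
        using that by (intro weight_pos_chain[OF V(1) x0]) (auto simp: D_def colourings_def)
    qed (use finite_colourings[OF V(1), of E q] in \<open>auto simp: D_def\<close>)
    moreover have "(\<Sum>c\<in>D. weight V q c x * h c) = (\<Sum>c\<in>?C. weight V q c x * h c)" for h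
    proof (rule sum.mono_neutral_left)
      show "\<forall>c\<in>?C - D. weight V q c x * h c = 0"
        using weight_nonneg[where x = x, OF x0] by (auto simp: D_def not_less intro: antisym)
    qed (use finite_colourings[OF V(1)] in \<open>auto simp: D_def\<close>)
    ultimately show "\<exists>j\<in>{1..n}. \<exists>i\<in>{1..q}. \<exists>i'\<in>{1..q}.
      (\<Sum>c\<in>?C. weight V q c x * label q m P (p @ r) c j i) \<noteq> (\<Sum>c\<in>?C. weight V q c x * label q m P (p @ r) c j i')"
      by simp
  qed (rule colourings_permute label_permute colour_word_nonempty[OF _ xs(2)] | assumption)+
qed

theorem theorem4p4:
  fixes V :: "'v set" and E EH :: "'v set set" and P :: "nat \<Rightarrow> 'v set"
    and m n q :: nat and p :: "'v list"
  assumes "finite_graph V E"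
    and "V = (\<Union>j\<in>{1..m}. P j)" and "disjoint_family_on P {1..m}"
    and "n \<ge> m + 1" and "q \<ge> 2"
    and "\<forall>j\<in>{1..m}. card (P j) \<ge> q - 1"
    and "card V \<le> (q - 1) * n + 1"
    and "\<nexists>f. equivariant_map q n (independence_complex V E) f"
    and "simple_graph_path V p"
    and "EH = E \<union> path_edges p"
  shows "\<exists>S. (\<forall>i\<in>{1..q}. independent_set V EH (S i)) \<and> almost_fair_splitting V m P q S"
proof (rule ccontr)
  assume "\<not> ?thesis"
  then have no_splitting: "\<nexists>S. (\<forall>i\<in>{1..q}. independent_set V (E \<union> path_edges p) (S i)) \<and>
      almost_fair_splitting V m P q S"
    unfolding assms(10) .
  have "finite V" "m \<le> n" using assms(1,4) by (simp_all add: finite_graph_def)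
  then have "\<exists>f. equivariant_map q n (independence_complex V E) f"
    by (rule ex_equivariant_map_if_no_splitting[OF _ assms(2,3) _ assms(5-7,9) no_splitting])
  with assms(8) show False by (rule notE)
qed

end
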